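(* Let $G=(V,E)$ be a graph, let $C\subseteq V$ induce an odd cycle in $G$, and let $k\in V\setminus C$. Then every $X_{C\cup\{k\}}=(X_{ij})_{i,j\in C\cup\{k\}}\in\mathrm{STAB}^2(G_{C\cup\{k\}})$ satisfies $$\sum_{i\in C}X_{ik}\le\tfrac12(|C|-1)X_{kk}$$ and $$\sum_{i\in C}X_{ii}+\tfrac12(|C|-1)X_{kk}\le\tfrac12(|C|-1)+\sum_{i\in C}X_{ik}.$$
   Context: Graphs are finite, simple and undirected. For $I\subseteq V$, $G_I$ is the subgraph of $G$ induced by $I$. A cycle is a sequence of distinct vertices $i_1,\dots,i_k$ ($k\ge3$) such that consecutive vertices are adjacent and $i_k$ is adjacent to $i_1$; it may have chords (further edges between its vertices). An odd cycle is a cycle with an odd number of vertices. A set $C$ induces an odd cycle in $G$ if $C$ is the vertex set of an odd cycle in $G$. For a graph $H$, $\mathcal{S}(H)\subseteq\{0,1\}^{V(H)}$ is the set of incidence vectors of stable sets of $H$ (including the empty set), $\mathcal{S}^2(H)=\{ss^\top : s\in\mathcal{S}(H)\}$, and $\mathrm{STAB}^2(H)=\mathrm{conv}\,\mathcal{S}^2(H)$. *)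

theory Defs
  imports
    "HOL-Analysis.Analysis"
    "Graph_Theory.Digraph_Component"
    "Graph_Theory.Vertex_Walk"
begin

text \<open>
  A finite simple undirected graph is a symmetric, loop-free digraph without parallel arcs, i.e. an
  instance of the locale \<^locale>\<open>graph\<close>. Its vertex set is an arbitrary subset of a finite type
  \<open>'v\<close>. Vectors and matrices indexed by \<open>W \<subseteq> UNIV\<close> are the elements of \<open>real ^ 'v\<close> and
  \<open>real ^ 'v ^ 'v\<close> that vanish at every index outside \<open>W\<close>.
\<close>

definition is_cycle :: "('v, 'e) pre_digraph \<Rightarrow> 'v list \<Rightarrow> bool" where
  "is_cycle G p \<longleftrightarrow> 3 \<le> length p \<and> vpath p G \<and> last p \<rightarrow>\<^bsub>G\<^esub> hd p"

definition induces_odd_cycle :: "('v, 'e) pre_digraph \<Rightarrow> 'v set \<Rightarrow> bool" where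
  "induces_odd_cycle G C \<longleftrightarrow> (\<exists>p. is_cycle G p \<and> odd (length p) \<and> set p = C)"

definition stable_set :: "('v, 'e) pre_digraph \<Rightarrow> 'v set \<Rightarrow> bool" where
  "stable_set H S \<longleftrightarrow> S \<subseteq> verts H \<and> (\<forall>u\<in>S. \<forall>v\<in>S. \<not> u \<rightarrow>\<^bsub>H\<^esub> v)"

definition incidence_vector :: "'v::finite set \<Rightarrow> real ^ 'v" where
  "incidence_vector S = (\<chi> i. if i \<in> S then 1 else 0)"

definition stable_vectors :: "('v::finite, 'e) pre_digraph \<Rightarrow> (real ^ 'v) set" where
  "stable_vectors H = {incidence_vector S | S. stable_set H S}"

definition outer_square :: "real ^ 'v::finite \<Rightarrow> real ^ 'v ^ 'v" where
  "outer_square s = (\<chi> i j. s $ i * s $ j)"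

definition stable_matrices :: "('v::finite, 'e) pre_digraph \<Rightarrow> (real ^ 'v ^ 'v) set" where
  "stable_matrices H = outer_square ` stable_vectors H"

definition STAB2 :: "('v::finite, 'e) pre_digraph \<Rightarrow> (real ^ 'v ^ 'v) set" where
  "STAB2 H = convex hull (stable_matrices H)"

text \<open>The principal submatrix with rows and columns in \<open>W\<close>, again padded with zeros.\<close>

definition principal_submatrix :: "real ^ 'v ^ 'v \<Rightarrow> 'v::finite set \<Rightarrow> real ^ 'v ^ 'v" where
  "principal_submatrix X W = (\<chi> i j. if i \<in> W \<and> j \<in> W then X $ i $ j else 0)"

end

theory Submission
  imports Defs
begin

text \<open>
  Both inequalities are linear in the matrix, so it suffices to verify them at the vertices
  \<open>s s\<^sup>T\<close> of the polytope, where \<open>s\<close> is the incidence vector of a stable set \<open>S\<close>. There they only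
  involve the two numbers \<open>|S \<inter> C|\<close> and \<open>s\<^sub>k \<in> {0, 1}\<close>: they read
  \<open>|S \<inter> C| s\<^sub>k \<le> 1/2 (|C| - 1) s\<^sub>k\<close> and \<open>0 \<le> (1 - s\<^sub>k) (1/2 (|C| - 1) - |S \<inter> C|)\<close>. Hence both
  are the odd cycle inequality \<open>|S \<inter> C| \<le> 1/2 (|C| - 1)\<close>, multiplied by the nonnegative factors
  \<open>s\<^sub>k\<close> and \<open>1 - s\<^sub>k\<close> (\<open>odd_cycle_inequality\<close>, \<open>stable_matrix_odd_cycle_inequalities\<close>).
\<close>

lemma is_cycle_dominates_next:
  assumes "is_cycle G p" and "i < length p"
  shows "p ! i \<rightarrow>\<^bsub>G\<^esub> p ! (Suc i mod length p)"
proof (cases "Suc i < length p")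
  case True
  have "(p ! i, p ! Suc i) \<in> set (vwalk_arcs p)"
    using True
  proof (induction p arbitrary: i rule: vwalk_arcs.induct)
    case (3 x y zs)
    then show ?case by (cases i) auto
  qed auto
  moreover have "set (vwalk_arcs p) \<subseteq> arcs_ends G"
    using assms(1) by (auto simp: is_cycle_def vpath_def vwalk_def)
  ultimately show ?thesis
    using True by auto
next
  case False
  with assms(2) have "Suc i = length p" and "p \<noteq> []" by auto
  moreover from this have "i = length p - 1" by simp
  ultimately show ?thesis
    using assms(1) by (simp add: is_cycle_def last_conv_nth hd_conv_nth)
qed

text \<open>
  Moving every vertex of \<open>S\<close> on the cycle to its successor is an injection from \<open>S \<inter> C\<close> into
  \<open>C - S\<close>, so at most half of the cycle, rounded down, lies in \<open>S\<close>. The shift is carried out on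
  the positions of the list that represents the cycle. Independence is stated for \<open>S \<inter> C\<close>
  because \<open>S\<close> will be a stable set of an induced subgraph of \<open>G\<close> that contains the cycle.
\<close>

lemma odd_cycle_inequality:
  assumes "induces_odd_cycle G C"
    and "\<And>u v. u \<in> S \<inter> C \<Longrightarrow> v \<in> S \<inter> C \<Longrightarrow> \<not> u \<rightarrow>\<^bsub>G\<^esub> v"
  shows "real (card (S \<inter> C)) \<le> 1 / 2 * (real (card C) - 1)"
proof -
  obtain p where p: "is_cycle G p" "odd (length p)" "set p = C"
    using assms(1) by (auto simp: induces_odd_cycle_def)
  have "distinct p"
    using p(1) by (auto simp: is_cycle_def vpath_def)
  define n where "n = length p"
  define T where "T = {i. i < n \<and> p ! i \<in> S}"
  define next_pos where "next_pos i = Suc i mod n" for i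
  have "n > 0"
    using p(1) by (auto simp: n_def is_cycle_def)
  have "finite T" and "T \<subseteq> {..<n}"
    by (auto simp: T_def)
  have "card C = n"
    using \<open>distinct p\<close> p(3) by (auto simp: n_def distinct_card)
  have "(!) p ` T = S \<inter> C"
    using p(3) by (auto simp: T_def n_def in_set_conv_nth)
  moreover have "inj_on ((!) p) T"
    using \<open>distinct p\<close> by (auto simp: inj_on_def T_def n_def nth_eq_iff_index_eq)
  ultimately have card_T: "card T = card (S \<inter> C)"
    by (metis card_image)
  have "inj_on next_pos T"
    unfolding inj_on_def next_pos_def T_def
    by (auto simp: mod_Suc split: if_splits)
  then have "card (next_pos ` T) = card T"
    by (rule card_image)
  moreover have "next_pos ` T \<subseteq> {..<n}"
    using \<open>n > 0\<close> by (auto simp: next_pos_def)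
  moreover have "T \<inter> next_pos ` T = {}"
  proof -
    have False if "i \<in> T" "next_pos i \<in> T" for i
    proof -
      have "p ! i \<rightarrow>\<^bsub>G\<^esub> p ! next_pos i"
        using is_cycle_dominates_next[OF p(1)] that by (auto simp: T_def n_def next_pos_def)
      then show False
        using assms(2)[of "p ! i" "p ! next_pos i"] that p(3) by (auto simp: T_def n_def)
    qed
    then show ?thesis by auto
  qed
  ultimately have "2 * card T \<le> n"
    using card_Un_disjoint[of T "next_pos ` T"] card_mono[of "{..<n}" "T \<union> next_pos ` T"]
      \<open>finite T\<close> \<open>T \<subseteq> {..<n}\<close> by simp
  moreover have "2 * card T \<noteq> n"
    using p(2) unfolding n_def by (metis dvd_triv_left)
  ultimately have "2 * card T + 1 \<le> n"
    by simp
  then have "2 * real (card (S \<inter> C)) + 1 \<le> real (card C)"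
    unfolding card_T \<open>card C = n\<close> by linarith
  then show ?thesis by simp
qed

lemma stable_matrix_odd_cycle_inequalities:
  assumes "induces_odd_cycle G C"
    and "C \<subseteq> W"
    and "Y \<in> stable_matrices (G \<restriction> W)"
  shows "(\<Sum>i\<in>C. Y $ i $ k) \<le> 1 / 2 * (real (card C) - 1) * Y $ k $ k"
    and "(\<Sum>i\<in>C. Y $ i $ i) + 1 / 2 * (real (card C) - 1) * Y $ k $ k
         \<le> 1 / 2 * (real (card C) - 1) + (\<Sum>i\<in>C. Y $ i $ k)"
proof -
  obtain S where S: "stable_set (G \<restriction> W) S" and Y: "Y = outer_square (incidence_vector S)"
    using assms(3) by (auto simp: stable_matrices_def stable_vectors_def)
  have "\<not> u \<rightarrow>\<^bsub>G\<^esub> v" if "u \<in> S \<inter> C" "v \<in> S \<inter> C" for u v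
    using S that assms(2)
    by (fastforce simp: stable_set_def arcs_ends_def arc_to_ends_def)
  then have bound: "real (card (S \<inter> C)) \<le> 1 / 2 * (real (card C) - 1)"
    by (rule odd_cycle_inequality[OF assms(1)])
  have entry: "Y $ i $ j = (if i \<in> S \<and> j \<in> S then 1 else 0)" for i j
    by (simp add: Y outer_square_def incidence_vector_def)
  have "(\<Sum>i\<in>C. if i \<in> S then 1 else 0) = real (card (S \<inter> C))"
    by (simp add: Int_commute flip: sum.inter_restrict)
  then have diag: "(\<Sum>i\<in>C. Y $ i $ i) = real (card (S \<inter> C))"
    and col: "(\<Sum>i\<in>C. Y $ i $ k) = (if k \<in> S then real (card (S \<inter> C)) else 0)"
    and corner: "Y $ k $ k = (if k \<in> S then 1 else 0)"
    by (simp_all add: entry)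
  show "(\<Sum>i\<in>C. Y $ i $ k) \<le> 1 / 2 * (real (card C) - 1) * Y $ k $ k"
    using bound by (simp add: col corner)
  show "(\<Sum>i\<in>C. Y $ i $ i) + 1 / 2 * (real (card C) - 1) * Y $ k $ k
         \<le> 1 / 2 * (real (card C) - 1) + (\<Sum>i\<in>C. Y $ i $ k)"
    using bound by (simp add: diag col corner)
qed

lemma convex_hull_linear_le:
  fixes f :: "'a::real_vector \<Rightarrow> real"
  assumes "linear f" and "\<And>y. y \<in> A \<Longrightarrow> f y \<le> b" and "x \<in> convex hull A"
  shows "f x \<le> b"
proof -
  have "convex (f -` {..b})"
    using assms(1) by (intro convex_linear_vimage) auto
  then have "convex hull A \<subseteq> f -` {..b}"
    using assms(2) by (intro hull_minimal) auto
  then show ?thesis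
    using assms(3) by auto
qed

theorem lemma13:
  fixes G :: "('v::finite, 'e) pre_digraph"
    and C :: "'v set" and k :: 'v and X :: "real ^ 'v ^ 'v"
  assumes "graph G"
    and "C \<subseteq> verts G"
    and "induces_odd_cycle G C"
    and "k \<in> verts G - C"
    and "principal_submatrix X (C \<union> {k}) \<in> STAB2 (G \<restriction> (C \<union> {k}))"
  shows "(\<Sum>i\<in>C. X $ i $ k) \<le> 1 / 2 * (real (card C) - 1) * X $ k $ k
       \<and> (\<Sum>i\<in>C. X $ i $ i) + 1 / 2 * (real (card C) - 1) * X $ k $ k
         \<le> 1 / 2 * (real (card C) - 1) + (\<Sum>i\<in>C. X $ i $ k)"
proof -
  define m where "m = 1 / 2 * (real (card C) - 1)"
  define Z where "Z = principal_submatrix X (C \<union> {k})"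
  define f where "f Y = (\<Sum>i\<in>C. Y $ i $ k) - m * Y $ k $ k" for Y :: "real ^ 'v ^ 'v"
  define g where "g Y = (\<Sum>i\<in>C. Y $ i $ i) + m * Y $ k $ k - (\<Sum>i\<in>C. Y $ i $ k)"
    for Y :: "real ^ 'v ^ 'v"
  have Z: "Z \<in> convex hull stable_matrices (G \<restriction> (C \<union> {k}))"
    using assms(5) by (simp add: Z_def STAB2_def)
  have "linear f" "linear g"
    unfolding f_def g_def
    by (auto intro!: linearI simp: sum.distrib algebra_simps sum_distrib_left)
  note vertex_bounds = stable_matrix_odd_cycle_inequalities[OF assms(3), of "C \<union> {k}" _ k,
      folded m_def]
  have "f Z \<le> 0"
    using vertex_bounds(1) by (intro convex_hull_linear_le[OF \<open>linear f\<close> _ Z]) (auto simp: f_def)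
  moreover have "g Z \<le> m"
    using vertex_bounds(2)
    by (intro convex_hull_linear_le[OF \<open>linear g\<close> _ Z]) (fastforce simp: g_def)
  moreover have "f Z = f X" "g Z = g X"
    by (simp_all add: f_def g_def Z_def principal_submatrix_def)
  ultimately show ?thesis
    unfolding m_def[symmetric] by (simp add: f_def g_def)
qed

end
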